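(* Let $\Phi=(G,\varphi)$ be a $\mathbb{T}$-gain graph on a connected simple graph $G$ with $n$ vertices $v_1,\dots,v_n$ and at least one edge, and let $<$ be a total order on $V(G)$. Then (i) $\rho(\mathcal{DL}^{\max}_{<}(\Phi))\ge \frac{2W(G)}{n-1}$ and (ii) $\rho(\mathcal{DL}^{\min}_{<}(\Phi))\ge \frac{2W(G)}{n-1}$. Both inequalities are sharp, i.e. equality is attained for some such $\Phi$.
   Context: $\mathbb{T}=\{z\in\mathbb{C}:|z|=1\}$. A $\mathbb{T}$-gain graph $\Phi=(G,\varphi)$ assigns to each of the two orientations $\vec e_{i,j},\vec e_{j,i}$ of every edge $v_iv_j$ of $G$ a gain in $\mathbb{T}$ with $\varphi(\vec e_{j,i})=\overline{\varphi(\vec e_{i,j})}$; the gain of an oriented path is the product of the gains of its consecutive oriented edges. $d(u,v)$ is the shortest-path distance in $G$. For vertices $s<t$, $\varphi^{<}_{\max}(s,t)$ (resp. $\varphi^{<}_{\min}(s,t)$) is the maximum (resp. minimum) of the gains of all shortest oriented paths from $s$ to $t$, with respect to the lexicographic order on $\mathbb{C}$ ($a+ib\le c+id$ iff $a<c$, or $a=c$ and $b\le d$); further $\varphi^{<}_{\max}(t,s)=\overline{\varphi^{<}_{\max}(s,t)}$, $\varphi^{<}_{\min}(t,s)=\overline{\varphi^{<}_{\min}(s,t)}$, and both vanish on pairs $(s,s)$. $\mathcal{D}^{\max}_{<}(\Phi)=(\varphi^{<}_{\max}(v_i,v_j)d(v_i,v_j))_{i,j}$, $\mathcal{D}^{\min}_{<}(\Phi)=(\varphi^{<}_{\min}(v_i,v_j)d(v_i,v_j))_{i,j}$,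 $\mathrm{Tr}(G)=\mathrm{diag}(\mathrm{Tr}(v_1),\dots,\mathrm{Tr}(v_n))$ with $\mathrm{Tr}(v_i)=\sum_j d(v_i,v_j)$, $\mathcal{DL}^{\max}_{<}(\Phi)=\mathrm{Tr}(G)-\mathcal{D}^{\max}_{<}(\Phi)$, $\mathcal{DL}^{\min}_{<}(\Phi)=\mathrm{Tr}(G)-\mathcal{D}^{\min}_{<}(\Phi)$. $W(G)=\sum_{i>j}d(v_i,v_j)$ (the Wiener index, called "winner index" in the paper). $\rho(M)$ is the spectral radius (maximum modulus of an eigenvalue) of a square matrix $M$. *)

theory Defs
  imports
    "Graph_Theory.Graph_Theory"
    "Jordan_Normal_Form.Spectral_Radius"
begin

text \<open>
  A finite simple graph is a \<^locale>\<open>pair_graph\<close>: its arc relation is symmetric and loop-free, so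
  the arcs \<^term>\<open>(u, v)\<close> and \<^term>\<open>(v, u)\<close> are the two orientations of one edge.
\<close>

locale tgain_graph = pair_graph G for G :: "'a pair_pre_digraph" +
  fixes \<phi> :: "'a \<times> 'a \<Rightarrow> complex"
  assumes gain_unit: "(u, v) \<in> parcs G \<Longrightarrow> cmod (\<phi> (u, v)) = 1"
    and gain_reverse: "(u, v) \<in> parcs G \<Longrightarrow> \<phi> (v, u) = cnj (\<phi> (u, v))"

definition path_gain :: "('a \<times> 'a \<Rightarrow> complex) \<Rightarrow> ('a \<times> 'a) awalk \<Rightarrow> complex" where
  "path_gain \<phi> p = prod_list (map \<phi> p)"

definition gdist :: "'a pair_pre_digraph \<Rightarrow> 'a \<Rightarrow> 'a \<Rightarrow> real" where
  "gdist G u v = real_of_ereal (wf_digraph.\<mu> (with_proj G) (\<lambda>_. 1) u v)"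

definition shortest_paths :: "'a pair_pre_digraph \<Rightarrow> 'a \<Rightarrow> 'a \<Rightarrow> ('a \<times> 'a) awalk set" where
  "shortest_paths G u v =
     {p. pre_digraph.apath (with_proj G) u p v \<and> real (length p) = gdist G u v}"

definition shortest_gains ::
  "'a pair_pre_digraph \<Rightarrow> ('a \<times> 'a \<Rightarrow> complex) \<Rightarrow> 'a \<Rightarrow> 'a \<Rightarrow> complex set" where
  "shortest_gains G \<phi> u v = path_gain \<phi> ` shortest_paths G u v"

text \<open>The lexicographic order; the library's order on \<^typ>\<open>complex\<close> is a different, partial one.\<close>

definition lex_le :: "complex \<Rightarrow> complex \<Rightarrow> bool" where
  "lex_le z w \<longleftrightarrow> Re z < Re w \<or> (Re z = Re w \<and> Im z \<le> Im w)"

definition lex_Max :: "complex set \<Rightarrow> complex" where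
  "lex_Max S = (THE z. z \<in> S \<and> (\<forall>w\<in>S. lex_le w z))"

definition lex_Min :: "complex set \<Rightarrow> complex" where
  "lex_Min S = (THE z. z \<in> S \<and> (\<forall>w\<in>S. lex_le z w))"

text \<open>In the following, \<^term>\<open>r\<close> is the strict total order on the vertices.\<close>

definition gain_max ::
  "'a pair_pre_digraph \<Rightarrow> ('a \<times> 'a \<Rightarrow> complex) \<Rightarrow> 'a rel \<Rightarrow> 'a \<Rightarrow> 'a \<Rightarrow> complex" where
  "gain_max G \<phi> r s t =
     (if (s, t) \<in> r then lex_Max (shortest_gains G \<phi> s t)
      else if (t, s) \<in> r then cnj (lex_Max (shortest_gains G \<phi> t s))
      else 0)"

definition gain_min ::
  "'a pair_pre_digraph \<Rightarrow> ('a \<times> 'a \<Rightarrow> complex) \<Rightarrow> 'a rel \<Rightarrow> 'a \<Rightarrow> 'a \<Rightarrow> complex" where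
  "gain_min G \<phi> r s t =
     (if (s, t) \<in> r then lex_Min (shortest_gains G \<phi> s t)
      else if (t, s) \<in> r then cnj (lex_Min (shortest_gains G \<phi> t s))
      else 0)"

text \<open>
  Matrices and the Wiener index are taken with respect to an enumeration \<^term>\<open>vs\<close> of the vertices;
  the vertex \<open>v\<^sub>i\<close> is \<open>vs ! (i - 1)\<close>.
\<close>

definition Dmax ::
  "'a pair_pre_digraph \<Rightarrow> ('a \<times> 'a \<Rightarrow> complex) \<Rightarrow> 'a rel \<Rightarrow> 'a list \<Rightarrow> complex mat" where
  "Dmax G \<phi> r vs = mat (length vs) (length vs)
     (\<lambda>(i, j). gain_max G \<phi> r (vs ! i) (vs ! j) * of_real (gdist G (vs ! i) (vs ! j)))"

definition Dmin ::
  "'a pair_pre_digraph \<Rightarrow> ('a \<times> 'a \<Rightarrow> complex) \<Rightarrow> 'a rel \<Rightarrow> 'a list \<Rightarrow> complex mat" where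
  "Dmin G \<phi> r vs = mat (length vs) (length vs)
     (\<lambda>(i, j). gain_min G \<phi> r (vs ! i) (vs ! j) * of_real (gdist G (vs ! i) (vs ! j)))"

definition transmission :: "'a pair_pre_digraph \<Rightarrow> 'a \<Rightarrow> real" where
  "transmission G u = (\<Sum>v\<in>pverts G. gdist G u v)"

definition Tr_mat :: "'a pair_pre_digraph \<Rightarrow> 'a list \<Rightarrow> complex mat" where
  "Tr_mat G vs = mat (length vs) (length vs)
     (\<lambda>(i, j). if i = j then of_real (transmission G (vs ! i)) else 0)"

definition DLmax ::
  "'a pair_pre_digraph \<Rightarrow> ('a \<times> 'a \<Rightarrow> complex) \<Rightarrow> 'a rel \<Rightarrow> 'a list \<Rightarrow> complex mat" where
  "DLmax G \<phi> r vs = Tr_mat G vs - Dmax G \<phi> r vs"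

definition DLmin ::
  "'a pair_pre_digraph \<Rightarrow> ('a \<times> 'a \<Rightarrow> complex) \<Rightarrow> 'a rel \<Rightarrow> 'a list \<Rightarrow> complex mat" where
  "DLmin G \<phi> r vs = Tr_mat G vs - Dmin G \<phi> r vs"

definition wiener_index :: "'a pair_pre_digraph \<Rightarrow> 'a list \<Rightarrow> real" where
  "wiener_index G vs = (\<Sum>i<length vs. \<Sum>j<i. gdist G (vs ! i) (vs ! j))"

definition ordered_connected_tgain_graph ::
  "'a pair_pre_digraph \<Rightarrow> ('a \<times> 'a \<Rightarrow> complex) \<Rightarrow> 'a rel \<Rightarrow> 'a list \<Rightarrow> bool" where
  "ordered_connected_tgain_graph G \<phi> r vs \<longleftrightarrow>
     tgain_graph G \<phi> \<and> Digraph_Component.connected (with_proj G) \<and> parcs G \<noteq> {} \<and>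
     strict_linear_order_on (pverts G) r \<and> distinct vs \<and> set vs = pverts G"

end

theory Submission
  imports Defs "HOL-Analysis.L2_Norm"
begin

text \<open>
  Both matrices are Hermitian, with diagonal entries \<open>Tr(v\<^sub>i)\<close> and off-diagonal entries of modulus
  \<open>d(v\<^sub>i, v\<^sub>j)\<close>. For \<open>i \<noteq> j\<close> the Rayleigh quotient at \<open>e\<^sub>i + w e\<^sub>j\<close>, with the phase \<open>w\<close> chosen to make
  the cross terms positive, shows that \<open>2 \<rho> \<ge> Tr(v\<^sub>i) + Tr(v\<^sub>j) + 2 d(v\<^sub>i, v\<^sub>j)\<close>. The average of this over
  all pairs \<open>i \<noteq> j\<close> is \<open>\<rho> \<ge> 2 W / (n - 1)\<close>. Equality holds for a single edge with trivial gain.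
\<close>

section \<open>Hermitian matrices: Rayleigh quotients and the spectral radius\<close>

definition hermitian_mat :: "nat \<Rightarrow> complex mat \<Rightarrow> bool" where
  "hermitian_mat n A \<longleftrightarrow>
     A \<in> carrier_mat n n \<and> (\<forall>i<n. \<forall>j<n. A $$ (j, i) = cnj (A $$ (i, j)))"

lemma hermitian_mat_cscalar_prod:
  assumes A: "hermitian_mat n A" and u: "u \<in> carrier_vec n" and w: "w \<in> carrier_vec n"
  shows "(A *\<^sub>v u) \<bullet>c w = u \<bullet>c (A *\<^sub>v w)"
proof -
  have dim: "dim_row A = n" "dim_col A = n" "dim_vec u = n" "dim_vec w = n"
    using A u w by (auto simp: hermitian_mat_def)
  have "(A *\<^sub>v u) \<bullet>c w = (\<Sum>i<n. \<Sum>j<n. A $$ (i, j) * u $ j * cnj (w $ i))"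
    by (simp add: scalar_prod_def dim sum_distrib_right atLeast0LessThan)
  also have "\<dots> = (\<Sum>j<n. \<Sum>i<n. A $$ (i, j) * u $ j * cnj (w $ i))"
    by (rule sum.swap)
  also have "\<dots> = (\<Sum>j<n. \<Sum>i<n. u $ j * (cnj (A $$ (j, i)) * cnj (w $ i)))"
  proof (intro sum.cong refl)
    fix i j assume "i \<in> {..<n}" "j \<in> {..<n}"
    hence "A $$ (i, j) = cnj (A $$ (j, i))"
      using A unfolding hermitian_mat_def by blast
    thus "A $$ (i, j) * u $ j * cnj (w $ i) = u $ j * (cnj (A $$ (j, i)) * cnj (w $ i))"
      by (simp only: mult_ac)
  qed
  also have "\<dots> = u \<bullet>c (A *\<^sub>v w)"
    by (simp add: scalar_prod_def dim sum_distrib_left atLeast0LessThan)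
  finally show ?thesis .
qed

lemma pow_mat_add:
  fixes A :: "'a :: semiring_1 mat"
  assumes A: "A \<in> carrier_mat n n"
  shows "A ^\<^sub>m (k + l) = A ^\<^sub>m k * A ^\<^sub>m l"
proof (induction l)
  case 0
  then show ?case using A by (simp add: right_mult_one_mat[of _ n n])
next
  case (Suc l)
  then show ?case using A by (simp add: assoc_mult_mat[of _ n n _ n _ n])
qed

lemma hermitian_mat_pow_cscalar_prod:
  assumes A: "hermitian_mat n A" and u: "u \<in> carrier_vec n" and w: "w \<in> carrier_vec n"
  shows "(A ^\<^sub>m k *\<^sub>v u) \<bullet>c w = u \<bullet>c (A ^\<^sub>m k *\<^sub>v w)"
  using u w
proof (induction k arbitrary: u w)
  case 0
  then show ?case using A by (auto simp: hermitian_mat_def)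
next
  case (Suc k)
  have cA: "A \<in> carrier_mat n n" using A by (simp add: hermitian_mat_def)
  have cAk: "A ^\<^sub>m k \<in> carrier_mat n n" using cA by simp
  \<comment> \<open>The factors of \<open>A\<close> arrive on the right argument in the opposite
    order to the one in which the power recursion appends them, so \<open>A\<close> has to commute
    with its own powers.\<close>
  have comm: "A ^\<^sub>m k * A = A * A ^\<^sub>m k"
    using pow_mat_add[OF cA, of 1 k] pow_mat_add[OF cA, of k 1] cA by simp
  have "(A ^\<^sub>m Suc k *\<^sub>v u) \<bullet>c w = (A ^\<^sub>m k *\<^sub>v (A *\<^sub>v u)) \<bullet>c w"
    using cA cAk Suc.prems by (simp add: assoc_mult_mat_vec[of _ n n])
  also have "\<dots> = (A *\<^sub>v u) \<bullet>c (A ^\<^sub>m k *\<^sub>v w)"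
    using cA Suc by simp
  also have "\<dots> = u \<bullet>c (A *\<^sub>v (A ^\<^sub>m k *\<^sub>v w))"
    using cAk Suc.prems by (intro hermitian_mat_cscalar_prod[OF A]) auto
  also have "\<dots> = u \<bullet>c (A ^\<^sub>m Suc k *\<^sub>v w)"
    using cA cAk Suc.prems by (simp add: comm assoc_mult_mat_vec[of _ n n _ n])
  finally show ?case .
qed

lemma cscalar_prod_self:
  fixes u :: "complex vec"
  assumes "u \<in> carrier_vec n"
  shows "u \<bullet>c u = of_real (\<Sum>i<n. (cmod (u $ i))\<^sup>2)"
  using assms by (auto simp: scalar_prod_def atLeast0LessThan complex_norm_square simp flip: of_real_power intro!: sum.cong)

text \<open>The triangle inequality reduces this to the real Cauchy-Schwarz inequality for the
  moduli of the entries.\<close>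

lemma cscalar_prod_Cauchy_Schwarz:
  fixes u w :: "complex vec"
  assumes u: "u \<in> carrier_vec n" and w: "w \<in> carrier_vec n"
  shows "(cmod (u \<bullet>c w))\<^sup>2 \<le> Re (u \<bullet>c u) * Re (w \<bullet>c w)"
proof -
  have "cmod (u \<bullet>c w) \<le> (\<Sum>i<n. \<bar>cmod (u $ i)\<bar> * \<bar>cmod (w $ i)\<bar>)"
    using u w by (auto simp: scalar_prod_def atLeast0LessThan norm_mult intro!: sum_norm_le)
  also have "\<dots> \<le> L2_set (\<lambda>i. cmod (u $ i)) {..<n} * L2_set (\<lambda>i. cmod (w $ i)) {..<n}"
    by (rule L2_set_mult_ineq)
  finally have "(cmod (u \<bullet>c w))\<^sup>2 \<le>
      (L2_set (\<lambda>i. cmod (u $ i)) {..<n} * L2_set (\<lambda>i. cmod (w $ i)) {..<n})\<^sup>2"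
    by (intro power_mono) auto
  also have "\<dots> = Re (u \<bullet>c u) * Re (w \<bullet>c w)"
    by (simp add: cscalar_prod_self[OF u] cscalar_prod_self[OF w] power_mult_distrib L2_set_def
        sum_nonneg del: of_real_sum)
  finally show ?thesis .
qed

text \<open>An eigenvalue \<open>e\<close> of \<open>A / c\<close> makes \<open>c * e\<close> an
  eigenvalue of \<open>A\<close> with the same eigenvector, so \<open>c * cmod e\<close> is at most
  the spectral radius of \<open>A\<close>, which is below \<open>c\<close>.\<close>

lemma spectral_radius_smult_less_1:
  assumes A: "A \<in> carrier_mat n n" and n: "n > 0" and c: "spectral_radius A < c" "c > 0"
  shows "spectral_radius (of_real (1 / c) \<cdot>\<^sub>m A) < 1"
proof -
  let ?B = "of_real (1 / c) \<cdot>\<^sub>m A"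
  have B: "?B \<in> carrier_mat n n" using A by simp
  obtain e where e: "eigenvalue ?B e" "spectral_radius ?B = cmod e"
    using spectral_radius_mem_max(1)[OF B n] by (auto simp: spectrum_def)
  then obtain v where v: "v \<in> carrier_vec n" "v \<noteq> 0\<^sub>v n" "?B *\<^sub>v v = e \<cdot>\<^sub>v v"
    using A by (auto simp: eigenvalue_def eigenvector_def)
  have "A *\<^sub>v v = (of_real c * e) \<cdot>\<^sub>v v"
  proof (rule eq_vecI)
    fix i assume i: "i < dim_vec ((of_real c * e) \<cdot>\<^sub>v v)"
    hence "(?B *\<^sub>v v) $ i = (e \<cdot>\<^sub>v v) $ i" by (simp only: v(3))
    hence "of_real (1 / c) * (A *\<^sub>v v) $ i = e * v $ i"
      using i v(1) A by simp
    thus "(A *\<^sub>v v) $ i = ((of_real c * e) \<cdot>\<^sub>v v) $ i"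
      using i c(2) by (simp add: field_simps)
  qed (use A v(1) in auto)
  hence "eigenvalue A (of_real c * e)"
    using A v by (auto simp: eigenvalue_def eigenvector_def)
  hence "cmod (of_real c * e) \<le> spectral_radius A"
    by (intro spectral_radius_mem_max(2)[OF A n]) (auto simp: spectrum_def)
  hence "c * cmod e \<le> spectral_radius A" using c(2) by (simp add: norm_mult)
  hence "c * cmod e < c * 1" using c(1) by linarith
  hence "cmod e < 1" using c(2) by (simp only: mult_less_cancel_left_pos)
  thus ?thesis using e(2) by simp
qed

text \<open>
  If the Rayleigh quotient of \<open>x\<close> exceeded \<open>c > \<rho>(A)\<close>, then \<open>B = A / c\<close> would have bounded
  powers, whereas \<open>s k = \<langle>B\<^sup>k x, x\<rangle>\<close> satisfies \<open>s (2 k) \<ge> s k\<^sup>2 / s 0\<close> by Cauchy--Schwarz and hence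
  is unbounded along the powers of two.
\<close>

lemma hermitian_mat_Rayleigh_le_spectral_radius:
  assumes A: "hermitian_mat n A" and x: "x \<in> carrier_vec n"
  shows "Re ((A *\<^sub>v x) \<bullet>c x) \<le> spectral_radius A * Re (x \<bullet>c x)"
\<comment> \<open>Splitting off the zero vector permits division by the squared norm. It also
  disposes of dimension 0, where the spectral radius is the maximum of an empty set.\<close>
proof (cases "x = 0\<^sub>v n")
  case True
  have "A *\<^sub>v x = 0\<^sub>v n" using A True by (intro eq_vecI) (auto simp: hermitian_mat_def)
  then show ?thesis using True by simp
next
  case False
  define N where "N = Re (x \<bullet>c x)"
  have cA: "A \<in> carrier_mat n n" using A by (simp add: hermitian_mat_def)
  have "x \<bullet>c x \<noteq> 0" using False x by simp
  hence "N \<noteq> 0" unfolding N_def cscalar_prod_self[OF x] by (simp del: of_real_sum)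
  moreover have "N \<ge> 0" unfolding N_def cscalar_prod_self[OF x] by (simp add: sum_nonneg)
  ultimately have N: "N > 0" by simp
  have n: "n > 0"
  proof (rule ccontr)
    assume "\<not> n > 0"
    hence "x = 0\<^sub>v n" using x by (intro eq_vecI) auto
    thus False using False by simp
  qed
  show ?thesis
  proof (rule ccontr)
    assume "\<not> ?thesis"
    hence "spectral_radius A < Re ((A *\<^sub>v x) \<bullet>c x) / N"
      using N by (simp add: N_def field_simps)
    \<comment> \<open>With \<open>c\<close> strictly in between, dividing \<open>A\<close> by
      \<open>c\<close> brings the spectral radius below 1 and keeps the Rayleigh quotient at
      \<open>x\<close>, which is \<open>m\<close> below, above 1.\<close>
    then obtain c where c: "spectral_radius A < c" "c < Re ((A *\<^sub>v x) \<bullet>c x) / N"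
      using dense by blast
    have "spectral_radius A \<ge> 0" using spectral_radius_mem_max(1)[OF cA n] by auto
    hence c0: "c > 0" using c by simp
    define B where "B = of_real (1 / c) \<cdot>\<^sub>m A"
    have cB: "B \<in> carrier_mat n n" using cA by (simp add: B_def)
    have cBk: "B ^\<^sub>m k \<in> carrier_mat n n" for k using cB by simp
    have hB: "hermitian_mat n B"
      unfolding hermitian_mat_def
    proof (intro conjI allI impI cB)
      fix i j assume ij: "i < n" "j < n"
      hence "A $$ (j, i) = cnj (A $$ (i, j))" using A unfolding hermitian_mat_def by blast
      thus "B $$ (j, i) = cnj (B $$ (i, j))" using ij cA by (simp add: B_def)
    qed
    have "spectral_radius B < 1"
      unfolding B_def by (rule spectral_radius_smult_less_1[OF cA n c(1) c0])
    then obtain b where b: "\<And>k. norm_bound (B ^\<^sub>m k) b"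
      using spectral_radius_jnf_norm_bound_less_1_upper_triangular[OF cB] by blast
    define s where "s k = Re ((B ^\<^sub>m k *\<^sub>v x) \<bullet>c x)" for k
    define m where "m = s 1 / N"
    have "(B *\<^sub>v x) \<bullet>c x = of_real (1 / c) * ((A *\<^sub>v x) \<bullet>c x)"
      using cA x
      by (simp add: B_def scalar_prod_def sum_distrib_left sum_distrib_right sum_divide_distrib)
    hence "c * s 1 = Re ((A *\<^sub>v x) \<bullet>c x)"
      using cB c0 by (simp add: s_def)
    moreover have "c * N < Re ((A *\<^sub>v x) \<bullet>c x)"
      using c(2) N by (simp add: pos_less_divide_eq)
    ultimately have "c * N < c * s 1" by simp
    hence "N < s 1" using c0 by (simp only: mult_less_cancel_left_pos)
    hence m1: "m > 1" using N by (simp add: m_def)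
    \<comment> \<open>Moving half of the factors to the other side shows that
      \<open>s (2 * k)\<close> is the squared norm of the \<open>k\<close>-th power of
      \<open>B\<close> applied to \<open>x\<close>; Cauchy-Schwarz against \<open>x\<close> does the
      rest.\<close>
    have doubling: "(s k)\<^sup>2 \<le> s (2 * k) * N" for k
    proof -
      have u: "B ^\<^sub>m k *\<^sub>v x \<in> carrier_vec n"
        by (rule mult_mat_vec_carrier[OF cBk x])
      have "(B ^\<^sub>m (2 * k) *\<^sub>v x) \<bullet>c x = (B ^\<^sub>m k *\<^sub>v (B ^\<^sub>m k *\<^sub>v x)) \<bullet>c x"
        using pow_mat_add[OF cB, of k k] cBk[of k] x
        by (simp add: mult_2 assoc_mult_mat_vec[of _ n n])
      also have "\<dots> = (B ^\<^sub>m k *\<^sub>v x) \<bullet>c (B ^\<^sub>m k *\<^sub>v x)"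
        by (rule hermitian_mat_pow_cscalar_prod[OF hB u x])
      finally have "s (2 * k) = Re ((B ^\<^sub>m k *\<^sub>v x) \<bullet>c (B ^\<^sub>m k *\<^sub>v x))"
        by (simp add: s_def)
      moreover have "(s k)\<^sup>2 \<le> (cmod ((B ^\<^sub>m k *\<^sub>v x) \<bullet>c x))\<^sup>2"
        unfolding s_def by (simp add: cmod_power2)
      ultimately show ?thesis
        using cscalar_prod_Cauchy_Schwarz[OF u x] by (simp add: N_def)
    qed
    \<comment> \<open>The base case is an equality by the choice of \<open>m\<close>. Squaring the
      bound at exponent \<open>2 ^ k\<close>, applying doubling and cancelling one factor
      \<open>N\<close> gives the bound at \<open>2 ^ Suc k\<close>.\<close>
    have growth: "N * m ^ (2 ^ k) \<le> s (2 ^ k)" for k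
    proof (induction k)
      case 0
      then show ?case using N by (simp add: m_def)
    next
      case (Suc k)
      have "(N * m ^ (2 ^ k))\<^sup>2 \<le> (s (2 ^ k))\<^sup>2"
        using Suc m1 N by (intro power_mono) auto
      also have "\<dots> \<le> s (2 ^ Suc k) * N" using doubling[of "2 ^ k"] by simp
      also have "(N * m ^ (2 ^ k))\<^sup>2 = N * (N * m ^ (2 ^ Suc k))"
        by (simp only: power_mult_distrib power_Suc2[of 2] power_mult power2_eq_square[of N] mult.assoc)
      finally have "N * (N * m ^ (2 ^ Suc k)) \<le> N * s (2 ^ Suc k)"
        by (simp only: mult.commute)
      thus ?case using N by simp
    qed
    \<comment> \<open>The uniform bound \<open>b\<close> on the entries of all powers of
      \<open>B\<close> bounds the quadratic form at \<open>x\<close> independently of the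
      exponent.\<close>
    define M where "M = (\<Sum>i<n. \<Sum>j<n. b * cmod (x $ j) * cmod (x $ i))"
    have bounded: "s k \<le> M" for k
    proof -
      have "(B ^\<^sub>m k *\<^sub>v x) \<bullet>c x = (\<Sum>i<n. \<Sum>j<n. (B ^\<^sub>m k) $$ (i, j) * x $ j * cnj (x $ i))"
        using cB x by (simp add: scalar_prod_def sum_distrib_right atLeast0LessThan)
      moreover have "cmod \<dots> \<le> M"
        unfolding M_def
      proof (intro sum_norm_le)
        fix i j assume "i \<in> {..<n}" "j \<in> {..<n}"
        hence "cmod ((B ^\<^sub>m k) $$ (i, j)) \<le> b"
          using b[of k] cB by (simp add: norm_bound_def)
        thus "cmod ((B ^\<^sub>m k) $$ (i, j) * x $ j * cnj (x $ i)) \<le> b * cmod (x $ j) * cmod (x $ i)"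
          by (simp add: norm_mult mult_right_mono)
      qed
      ultimately have "cmod ((B ^\<^sub>m k *\<^sub>v x) \<bullet>c x) \<le> M" by simp
      thus ?thesis unfolding s_def using complex_Re_le_cmod order_trans by blast
    qed
    \<comment> \<open>Growth is known only at exponents that are powers of two; since
      \<open>m > 1\<close>, passing from \<open>k\<close> to the larger exponent
      \<open>2 ^ k\<close> preserves the strict bound.\<close>
    obtain k where k: "M / N < m ^ k" using real_arch_pow[OF m1] by blast
    also have "m ^ k \<le> m ^ (2 ^ k)"
      using m1 by (intro power_increasing) (auto simp: less_imp_le)
    finally have "M < N * m ^ (2 ^ k)" using N by (simp add: field_simps)
    thus False using growth[of k] bounded[of "2 ^ k"] by simp
  qed
qed

section \<open>Averaging the Rayleigh bound over pairs of indices\<close>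

text \<open>The factor 2 on the right is the squared norm of the test vector, which has entries 1
  and \<open>w\<close> of modulus 1. The two cross terms are conjugate to each other, and each
  becomes \<open>cmod (A $$ (i, j))\<close>.\<close>

lemma hermitian_mat_two_diag_entries_le:
  assumes A: "hermitian_mat n A" and i: "i < n" and j: "j < n" and ij: "i \<noteq> j"
  shows "Re (A $$ (i, i)) + Re (A $$ (j, j)) + 2 * cmod (A $$ (i, j)) \<le> 2 * spectral_radius A"
proof -
  have cA: "A \<in> carrier_mat n n" using A by (simp add: hermitian_mat_def)
  \<comment> \<open>The phase that cancels the one of \<open>A $$ (i, j)\<close>. A zero entry needs
    its own case because \<open>sgn 0 = 0\<close> is not a unit.\<close>
  define w where "w = (if A $$ (i, j) = 0 then 1 else cnj (sgn (A $$ (i, j))))"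
  have "cmod w = 1" by (simp add: w_def norm_sgn)
  hence w1: "w * cnj w = 1" by (simp flip: complex_norm_square)
  have Aw: "A $$ (i, j) * w = of_real (cmod (A $$ (i, j)))"
    by (auto simp: w_def sgn_eq power2_eq_square simp flip: complex_norm_square)
  have ji: "A $$ (j, i) * cnj w = of_real (cmod (A $$ (i, j)))"
  proof -
    have "A $$ (j, i) = cnj (A $$ (i, j))" using A i j unfolding hermitian_mat_def by blast
    thus ?thesis using arg_cong[OF Aw, of cnj] by simp
  qed
  define x where "x = vec n (\<lambda>k. if k = i then 1 else if k = j then w else 0)"
  have x: "x \<in> carrier_vec n" by (simp add: x_def)
  have xij: "x $ i = 1" "x $ j = w" using i j ij by (simp_all add: x_def)
  have two: "(\<Sum>k<n. f k) = f i + f j" if "\<And>k. k < n \<Longrightarrow> k \<noteq> i \<Longrightarrow> k \<noteq> j \<Longrightarrow> f k = 0"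
    for f :: "nat \<Rightarrow> complex"
  proof -
    have "(\<Sum>k<n. f k) = (\<Sum>k\<in>{i, j}. f k)"
      using i j that by (intro sum.mono_neutral_right) auto
    thus ?thesis using ij by simp
  qed
  have "x \<bullet>c x = (\<Sum>k<n. x $ k * cnj (x $ k))"
    using x by (simp add: scalar_prod_def atLeast0LessThan)
  also have "\<dots> = x $ i * cnj (x $ i) + x $ j * cnj (x $ j)"
    by (rule two) (auto simp: x_def)
  also have "\<dots> = 2" using w1 by (simp add: xij)
  finally have xx: "x \<bullet>c x = 2" .
  have row: "(A *\<^sub>v x) $ k = A $$ (k, i) + A $$ (k, j) * w" if "k < n" for k
  proof -
    have "(A *\<^sub>v x) $ k = (\<Sum>l<n. A $$ (k, l) * x $ l)"
      using cA that x by (simp add: scalar_prod_def atLeast0LessThan)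
    also have "\<dots> = A $$ (k, i) * x $ i + A $$ (k, j) * x $ j"
      by (rule two) (auto simp: x_def)
    finally show ?thesis by (simp add: xij)
  qed
  have "(A *\<^sub>v x) \<bullet>c x = (\<Sum>k<n. (A *\<^sub>v x) $ k * cnj (x $ k))"
    using cA x by (simp add: scalar_prod_def atLeast0LessThan)
  also have "\<dots> = (A *\<^sub>v x) $ i * cnj (x $ i) + (A *\<^sub>v x) $ j * cnj (x $ j)"
    by (rule two) (auto simp: x_def)
  also have "\<dots> = A $$ (i, i) + A $$ (i, j) * w + (A $$ (j, i) * cnj w + A $$ (j, j) * (w * cnj w))"
    using i j by (simp add: row xij algebra_simps)
  also have "\<dots> = A $$ (i, i) + A $$ (j, j) + 2 * of_real (cmod (A $$ (i, j)))"
    by (simp add: Aw ji w1)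
  finally show ?thesis
    using hermitian_mat_Rayleigh_le_spectral_radius[OF A x] by (simp add: xx)
qed

text \<open>Let S be the sum of the row sums. Adding the two-entry bounds over all pairs gives 2 n S
  + 2 S on the left and 2 S + 2 n (n - 1) \<rho> on the right; cancel 2 S and divide by 2 n.\<close>

lemma hermitian_mat_distance_Laplacian_bound:
  fixes d :: "nat \<Rightarrow> nat \<Rightarrow> real"
  assumes A: "hermitian_mat n A" and n: "n > 0"
    and d0: "\<And>i. i < n \<Longrightarrow> d i i = 0"
    and diag: "\<And>i. i < n \<Longrightarrow> A $$ (i, i) = of_real (\<Sum>j<n. d i j)"
    and off: "\<And>i j. i < n \<Longrightarrow> j < n \<Longrightarrow> i \<noteq> j \<Longrightarrow> cmod (A $$ (i, j)) = d i j"
  shows "(\<Sum>i<n. \<Sum>j<n. d i j) \<le> spectral_radius A * (real n - 1)"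
proof -
  define T where "T i = (\<Sum>j<n. d i j)" for i
  define S where "S = (\<Sum>i<n. T i)"
  let ?\<rho> = "spectral_radius A"
  \<comment> \<open>The two-entry bound needs distinct indices. On the diagonal
    \<open>d i i = 0\<close> gives equality with \<open>2 * T i\<close>, so both sums can run over
    the full square.\<close>
  have "T i + T j + 2 * d i j \<le> (if j = i then 2 * T i else 2 * ?\<rho>)" if "i < n" "j < n" for i j
    using hermitian_mat_two_diag_entries_le[OF A that] diag off d0 that by (auto simp: T_def)
  hence "(\<Sum>i<n. \<Sum>j<n. T i + T j + 2 * d i j)
      \<le> (\<Sum>i<n. \<Sum>j<n. if j = i then 2 * T i else 2 * ?\<rho>)"
    by (intro sum_mono) auto
  also have "\<dots> = (\<Sum>i<n. 2 * T i + 2 * ?\<rho> * (real n - 1))"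
  proof (rule sum.cong[OF refl])
    fix i assume i: "i \<in> {..<n}"
    have "(\<Sum>j<n. if j = i then 2 * T i else 2 * ?\<rho>)
        = 2 * T i + (\<Sum>j\<in>{..<n} - {i}. if j = i then 2 * T i else 2 * ?\<rho>)"
      using i by (subst sum.remove[of _ i]) auto
    also have "(\<Sum>j\<in>{..<n} - {i}. if j = i then 2 * T i else 2 * ?\<rho>)
        = (\<Sum>j\<in>{..<n} - {i}. 2 * ?\<rho>)"
      by (rule sum.cong) auto
    also have "\<dots> = 2 * ?\<rho> * (real n - 1)"
      using i n by (simp add: of_nat_diff)
    finally show "(\<Sum>j<n. if j = i then 2 * T i else 2 * ?\<rho>) = 2 * T i + 2 * ?\<rho> * (real n - 1)" .
  qed
  also have "\<dots> = 2 * S + 2 * real n * (?\<rho> * (real n - 1))"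
    by (simp add: sum.distrib S_def sum_distrib_left)
  also have "(\<Sum>i<n. \<Sum>j<n. T i + T j + 2 * d i j) = 2 * real n * S + 2 * S"
    by (simp add: sum.distrib S_def T_def sum_distrib_left[symmetric])
  finally have "(2 * real n) * S \<le> (2 * real n) * (?\<rho> * (real n - 1))" by simp
  hence "S \<le> ?\<rho> * (real n - 1)" using n by simp
  thus ?thesis by (simp add: S_def T_def)
qed

section \<open>Extremal elements in the lexicographic order\<close>

lemma lex_le_linear: "lex_le z w \<or> lex_le w z"
  by (auto simp: lex_le_def)

lemma lex_le_trans: "lex_le z w \<Longrightarrow> lex_le w y \<Longrightarrow> lex_le z y"
  by (auto simp: lex_le_def)

lemma lex_le_antisym: "lex_le z w \<Longrightarrow> lex_le w z \<Longrightarrow> z = w"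
  by (auto simp: lex_le_def complex_eq_iff)

lemma finite_lex_extremal:
  assumes "finite S" "S \<noteq> {}"
  shows "\<exists>z\<in>S. \<forall>w\<in>S. lex_le w z" "\<exists>z\<in>S. \<forall>w\<in>S. lex_le z w"
proof -
  show "\<exists>z\<in>S. \<forall>w\<in>S. lex_le w z"
    using assms
  proof (induction rule: finite_ne_induct)
    case (insert x F)
    then obtain z where "z \<in> F" "\<forall>w\<in>F. lex_le w z" by blast
    then show ?case using lex_le_linear[of x z] lex_le_linear[of x x] lex_le_trans by blast
  qed (use lex_le_linear in blast)
  show "\<exists>z\<in>S. \<forall>w\<in>S. lex_le z w"
    using assms
  proof (induction rule: finite_ne_induct)
    case (insert x F)
    then obtain z where "z \<in> F" "\<forall>w\<in>F. lex_le z w" by blast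
    then show ?case using lex_le_linear[of x z] lex_le_linear[of x x] lex_le_trans by blast
  qed (use lex_le_linear in blast)
qed

text \<open>A finite nonempty set has a largest element, unique by antisymmetry, so the definite
  description denotes it. Membership carries properties shared by all shortest gains, such as
  modulus 1, over to the extremal one.\<close>

lemma lex_Max_in:
  assumes "finite S" "S \<noteq> {}"
  shows "lex_Max S \<in> S"
proof -
  have "\<exists>!z. z \<in> S \<and> (\<forall>w\<in>S. lex_le w z)"
    using finite_lex_extremal(1)[OF assms] lex_le_antisym by blast
  from theI'[OF this] show ?thesis by (simp add: lex_Max_def)
qed

lemma lex_Min_in:
  assumes "finite S" "S \<noteq> {}"
  shows "lex_Min S \<in> S"
proof -
  have "\<exists>!z. z \<in> S \<and> (\<forall>w\<in>S. lex_le z w)"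
    using finite_lex_extremal(2)[OF assms] lex_le_antisym by blast
  from theI'[OF this] show ?thesis by (simp add: lex_Min_def)
qed

section \<open>Distances and gains of shortest paths\<close>

context tgain_graph
begin

text \<open>Unit weights turn the minimal walk cost behind \<open>gdist\<close> into a count of
  arcs.\<close>

lemma awalk_cost_1 [simp]: "awalk_cost (\<lambda>_. 1) p = real (length p)"
  by (induction p) auto

lemma cmod_path_gain:
  assumes "awalk u p v"
  shows "cmod (path_gain \<phi> p) = 1"
proof -
  have "set p \<subseteq> parcs G" using assms by (simp add: awalk_def)
  thus ?thesis
    by (induction p) (auto simp: path_gain_def norm_mult gain_unit)
qed

lemma exists_shortest_path:
  assumes "Digraph_Component.connected (with_proj G)" "u \<in> pverts G" "v \<in> pverts G"
  shows "\<exists>p. apath u p v \<and> gdist G u v = real (length p)"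
proof -
  \<comment> \<open>Connectedness is strong connectedness of the symmetric closure; the arcs are
    already symmetric, so it yields reachability in the graph itself.\<close>
  have "u \<rightarrow>\<^sup>*\<^bsub>with_proj G\<^esub> v"
    using assms reachable_mk_symmetric_eq[OF pair_sym_arcs]
    by (auto simp: Digraph_Component.connected_def strongly_connected_def)
  from min_cost_awalk[OF this, of "\<lambda>_. 1"] obtain p
    where "apath u p v" "\<mu> (\<lambda>_. 1) u v = awalk_cost (\<lambda>_. 1) p" by auto
  thus ?thesis by (auto simp: gdist_def)
qed

lemma gdist_le_length:
  assumes "awalk u p v"
  shows "gdist G u v \<le> real (length p)"
proof -
  have "\<mu> (\<lambda>_. 1) u v \<le> ereal (real (length p))"
    using min_cost_le_walk_cost[OF assms, of "\<lambda>_. 1"] by simp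
  \<comment> \<open>The two bounds confine the cost to finite values, so that
    \<open>real_of_ereal\<close>, which sends infinities to 0, loses nothing.\<close>
  moreover have "\<mu> (\<lambda>_. 1) u v \<ge> 0"
    unfolding \<mu>_def by (rule INF_greatest) simp
  ultimately show ?thesis
    unfolding gdist_def by (cases "\<mu> (\<lambda>_. 1) u v") auto
qed

lemma gdist_refl:
  assumes "Digraph_Component.connected (with_proj G)" "u \<in> pverts G"
  shows "gdist G u u = 0"
proof -
  have "awalk u [] u" using assms(2) by (simp add: awalk_Nil_iff)
  thus ?thesis
    using gdist_le_length exists_shortest_path[OF assms assms(2)] by force
qed

text \<open>Reversing a shortest path gives a walk of the same length, hence one inequality;
  exchanging the endpoints gives the other.\<close>

lemma gdist_sym:
  assumes "Digraph_Component.connected (with_proj G)" "u \<in> pverts G" "v \<in> pverts G"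
  shows "gdist G u v = gdist G v u"
proof -
  have *: "gdist G u v \<le> gdist G v u" if "u \<in> pverts G" "v \<in> pverts G" for u v
  proof -
    obtain p where p: "apath v p u" "gdist G v u = real (length p)"
      using exists_shortest_path[OF assms(1) \<open>v \<in> pverts G\<close> \<open>u \<in> pverts G\<close>] by blast
    have "awalk u (rev_path p) v" using p(1) by (simp add: awalkI_apath)
    moreover have "length (rev_path p) = length p" by (induction p) auto
    ultimately show ?thesis using gdist_le_length p(2) by metis
  qed
  show ?thesis using *[of u v] *[of v u] assms by simp
qed

lemma shortest_gains_finite: "finite (shortest_gains G \<phi> u v)"
proof -
  have "shortest_paths G u v \<subseteq> {p. apath u p v}" by (auto simp: shortest_paths_def)
  thus ?thesis
    unfolding shortest_gains_def using apaths_finite finite_subset by blast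
qed

lemma shortest_gains_nonempty:
  assumes "Digraph_Component.connected (with_proj G)" "u \<in> pverts G" "v \<in> pverts G"
  shows "shortest_gains G \<phi> u v \<noteq> {}"
  using exists_shortest_path[OF assms] by (auto simp: shortest_gains_def shortest_paths_def)

lemma cmod_shortest_gains: "z \<in> shortest_gains G \<phi> u v \<Longrightarrow> cmod z = 1"
  by (auto simp: shortest_gains_def shortest_paths_def intro!: cmod_path_gain awalkI_apath)

end

section \<open>From gain graphs to matrices: the lower bound\<close>

text \<open>This identifies the sum of all transmissions with twice the Wiener index. In the
  induction a new index contributes a row and an equal column.\<close>

lemma sum_symmetric_zero_diag:
  fixes d :: "nat \<Rightarrow> nat \<Rightarrow> real"
  assumes "\<And>i. i < n \<Longrightarrow> d i i = 0" "\<And>i j. i < n \<Longrightarrow> j < n \<Longrightarrow> d i j = d j i"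
  shows "(\<Sum>i<n. \<Sum>j<n. d i j) = 2 * (\<Sum>i<n. \<Sum>j<i. d i j)"
  using assms
proof (induction n)
  case 0
  then show ?case by simp
next
  case (Suc n)
  have "(\<Sum>i<n. d i n) = (\<Sum>i<n. d n i)"
    by (intro sum.cong refl Suc.prems(2)) auto
  moreover have "d n n = 0" by (rule Suc.prems(1)) simp
  moreover have "(\<Sum>i<n. \<Sum>j<n. d i j) = 2 * (\<Sum>i<n. \<Sum>j<i. d i j)"
    by (rule Suc.IH) (auto intro: Suc.prems)
  ultimately show ?case by (simp add: sum.distrib)
qed

lemma transmission_eq_sum_nth:
  assumes "distinct vs" "set vs = pverts G"
  shows "transmission G u = (\<Sum>j<length vs. gdist G u (vs ! j))"
proof -
  have "bij_betw ((!) vs) {..<length vs} (pverts G)"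
    using bij_betw_nth[OF assms(1) refl refl] assms(2) by simp
  from sum.reindex_bij_betw[OF this, of "gdist G u"] show ?thesis
    by (simp add: transmission_def)
qed

text \<open>The abstract \<open>g\<close> stands for \<open>gain_max\<close> and
  \<open>gain_min\<close> alike: modulus 1 and conjugate symmetry off the diagonal make the matrix
  Hermitian with off-diagonal moduli equal to the distances.\<close>

lemma gain_distance_Laplacian_bound:
  assumes oc: "ordered_connected_tgain_graph G \<phi> r vs"
    and unit: "\<And>u v. u \<in> pverts G \<Longrightarrow> v \<in> pverts G \<Longrightarrow> u \<noteq> v \<Longrightarrow> cmod (g u v) = 1"
    and conj: "\<And>u v. u \<in> pverts G \<Longrightarrow> v \<in> pverts G \<Longrightarrow> u \<noteq> v \<Longrightarrow> g v u = cnj (g u v)"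
  shows "2 * wiener_index G vs / (real (card (pverts G)) - 1)
    \<le> spectral_radius (Tr_mat G vs - mat (length vs) (length vs)
         (\<lambda>(i, j). g (vs ! i) (vs ! j) * of_real (gdist G (vs ! i) (vs ! j))))"
    (is "_ \<le> spectral_radius ?A")
proof -
  from oc have conn: "Digraph_Component.connected (with_proj G)" and arcs: "parcs G \<noteq> {}"
    and vs: "distinct vs" "set vs = pverts G" and tg: "tgain_graph G \<phi>"
    by (auto simp: ordered_connected_tgain_graph_def)
  interpret tgain_graph G \<phi> by (rule tg)
  let ?n = "length vs"
  define d where "d i j = gdist G (vs ! i) (vs ! j)" for i j
  have V: "vs ! i \<in> pverts G" if "i < ?n" for i using that vs(2) nth_mem by blast
  have d0: "d i i = 0" if "i < ?n" for i
    using gdist_refl[OF conn V[OF that]] by (simp add: d_def)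
  have dsym: "d i j = d j i" if "i < ?n" "j < ?n" for i j
    unfolding d_def by (rule gdist_sym[OF conn V[OF that(1)] V[OF that(2)]])
  have dpos: "d i j \<ge> 0" if "i < ?n" "j < ?n" for i j
    using exists_shortest_path[OF conn V[OF that(1)] V[OF that(2)]] by (auto simp: d_def)
  have neq: "vs ! i \<noteq> vs ! j" if "i < ?n" "j < ?n" "i \<noteq> j" for i j
    using that vs(1) by (simp add: nth_eq_iff_index_eq)
  have entry_diag: "?A $$ (i, i) = of_real (\<Sum>j<?n. d i j)" if "i < ?n" for i
    using that d0[OF that] by (simp add: Tr_mat_def transmission_eq_sum_nth[OF vs] d_def)
  have entry_off: "?A $$ (i, j) = - (g (vs ! i) (vs ! j) * of_real (d i j))"
    if "i < ?n" "j < ?n" "i \<noteq> j" for i j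
    using that by (simp add: Tr_mat_def d_def)
  have herm: "hermitian_mat ?n ?A"
    unfolding hermitian_mat_def
  proof (intro conjI allI impI)
    fix i j assume ij: "i < ?n" "j < ?n"
    show "?A $$ (j, i) = cnj (?A $$ (i, j))"
    proof (cases "i = j")
      case True
      then show ?thesis by (simp only: entry_diag[OF ij(2)] complex_cnj_complex_of_real)
    next
      case False
      have "g (vs ! j) (vs ! i) = cnj (g (vs ! i) (vs ! j))"
        by (rule conj[OF V[OF ij(1)] V[OF ij(2)] neq[OF ij False]])
      then show ?thesis
        using entry_off[OF ij False] entry_off[OF ij(2,1)] dsym[OF ij] False by simp
    qed
  qed (simp add: Tr_mat_def minus_carrier_mat)
  have off: "cmod (?A $$ (i, j)) = d i j" if "i < ?n" "j < ?n" "i \<noteq> j" for i j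
    using entry_off[OF that] unit[OF V[OF that(1)] V[OF that(2)] neq[OF that]] dpos[OF that(1,2)]
    by (simp add: norm_mult)
  have card: "card (pverts G) = ?n" using vs distinct_card by metis
  obtain u v where "(u, v) \<in> parcs G" using arcs by auto
  \<comment> \<open>A loop-free arc has two distinct ends, so there are at least two vertices and
    the denominator is positive.\<close>
  hence "{u, v} \<subseteq> pverts G" "u \<noteq> v" by (auto dest: in_arcsD1 in_arcsD2 no_loops')
  hence n2: "?n \<ge> 2" using card_mono[OF pair_finite_verts, of "{u, v}"] card by simp
  have "2 * wiener_index G vs = (\<Sum>i<?n. \<Sum>j<?n. d i j)"
    using sum_symmetric_zero_diag[of ?n d] d0 dsym by (simp add: wiener_index_def d_def)
  also have "\<dots> \<le> spectral_radius ?A * (real ?n - 1)"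
    using n2 by (intro hermitian_mat_distance_Laplacian_bound herm d0 entry_diag off) auto
  finally show ?thesis using n2 by (simp add: card pos_divide_le_eq)
qed

lemma extremal_gain_unit_conj:
  assumes oc: "ordered_connected_tgain_graph G \<phi> r vs"
    and uv: "u \<in> pverts G" "v \<in> pverts G" "u \<noteq> v"
  shows "cmod (gain_max G \<phi> r u v) = 1" "cmod (gain_min G \<phi> r u v) = 1"
    "gain_max G \<phi> r v u = cnj (gain_max G \<phi> r u v)"
    "gain_min G \<phi> r v u = cnj (gain_min G \<phi> r u v)"
proof -
  from oc have conn: "Digraph_Component.connected (with_proj G)" and tg: "tgain_graph G \<phi>"
    and r: "strict_linear_order_on (pverts G) r"
    unfolding ordered_connected_tgain_graph_def by blast+
  interpret tgain_graph G \<phi> by (rule tg)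
  have unit: "cmod (lex_Max (shortest_gains G \<phi> s t)) = 1"
      "cmod (lex_Min (shortest_gains G \<phi> s t)) = 1" if "s \<in> pverts G" "t \<in> pverts G" for s t
    using lex_Max_in[OF shortest_gains_finite shortest_gains_nonempty[OF conn that]]
      lex_Min_in[OF shortest_gains_finite shortest_gains_nonempty[OF conn that]]
    by (auto intro: cmod_shortest_gains)
  \<comment> \<open>Totality rules out the default value 0 for distinct vertices; asymmetry ensures
    that swapping the vertices swaps the two conjugate branches.\<close>
  have tot: "(u, v) \<in> r \<or> (v, u) \<in> r"
    using r uv by (auto simp: strict_linear_order_on_def total_on_def)
  have asym: "\<not> ((u, v) \<in> r \<and> (v, u) \<in> r)"
    using r unfolding strict_linear_order_on_def irrefl_def by (meson transD)
  show "cmod (gain_max G \<phi> r u v) = 1" "cmod (gain_min G \<phi> r u v) = 1"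
    using tot unit uv by (auto simp: gain_max_def gain_min_def)
  show "gain_max G \<phi> r v u = cnj (gain_max G \<phi> r u v)"
    "gain_min G \<phi> r v u = cnj (gain_min G \<phi> r u v)"
    using tot asym by (auto simp: gain_max_def gain_min_def)
qed

lemma spectral_radius_DL_ge:
  assumes "ordered_connected_tgain_graph G \<phi> r vs"
  shows "2 * wiener_index G vs / (real (card (pverts G)) - 1) \<le> spectral_radius (DLmax G \<phi> r vs)"
    "2 * wiener_index G vs / (real (card (pverts G)) - 1) \<le> spectral_radius (DLmin G \<phi> r vs)"
  unfolding DLmax_def Dmax_def DLmin_def Dmin_def
  by (rule gain_distance_Laplacian_bound[OF assms extremal_gain_unit_conj(1,3)[OF assms]],
      assumption+)
    (rule gain_distance_Laplacian_bound[OF assms extremal_gain_unit_conj(2,4)[OF assms]],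
      assumption+)

section \<open>Sharpness: a single edge with trivial gain\<close>

definition K2 :: "nat pair_pre_digraph" where
  "K2 = \<lparr>pverts = {0, 1}, parcs = {(0, 1), (1, 0)}\<rparr>"

lemma K2_simps [simp]: "pverts K2 = {0, 1}" "parcs K2 = {(0, 1), (1, 0)}"
  by (simp_all add: K2_def)

lemma ordered_connected_K2: "ordered_connected_tgain_graph K2 (\<lambda>_. 1) {(0, 1)} [0, 1]"
proof -
  interpret tgain_graph K2 "\<lambda>_. 1"
    by unfold_locales (auto simp: symmetric_def sym_def)
  have "0 \<rightarrow>\<^bsub>with_proj K2\<^esub> 1" "1 \<rightarrow>\<^bsub>with_proj K2\<^esub> 0" by simp_all
  hence "u \<rightarrow>\<^sup>*\<^bsub>with_proj K2\<^esub> v" if "u \<in> {0, 1}" "v \<in> {0, 1}" for u v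
    using that by auto
  hence "Digraph_Component.connected (with_proj K2)"
    using reachable_mk_symmetric_eq[OF pair_sym_arcs]
    by (auto simp: Digraph_Component.connected_def strongly_connected_def)
  thus ?thesis
    using tgain_graph_axioms
    by (auto simp: ordered_connected_tgain_graph_def strict_linear_order_on_def trans_def
        irrefl_def total_on_def)
qed

lemma K2_gdist: "gdist K2 0 1 = 1" "gdist K2 1 0 = 1" "gdist K2 0 0 = 0" "gdist K2 1 1 = 0"
proof -
  have conn: "Digraph_Component.connected (with_proj K2)" and tg: "tgain_graph K2 (\<lambda>_. 1)"
    using ordered_connected_K2 by (auto simp: ordered_connected_tgain_graph_def)
  interpret tgain_graph K2 "\<lambda>_. 1" by (rule tg)
  obtain p where p: "apath 0 p 1" "gdist K2 0 1 = real (length p)"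
    using exists_shortest_path[OF conn, of 0 1] by auto
  have "p \<noteq> []" using p(1) by (auto simp: apath_def awalk_Nil_iff)
  hence "gdist K2 0 1 \<ge> 1" using p(2) by (cases p) auto
  moreover have "awalk 0 [(0, 1)] 1" by (simp add: awalk_def)
  from gdist_le_length[OF this] have "gdist K2 0 1 \<le> 1" by simp
  ultimately show *: "gdist K2 0 1 = 1" by simp
  show "gdist K2 1 0 = 1" using * gdist_sym[OF conn, of 0 1] by simp
  show "gdist K2 0 0 = 0" "gdist K2 1 1 = 0" using gdist_refl[OF conn] by auto
qed

text \<open>Every product of trivial gains is 1, so nonemptiness already determines the set, without
  listing the shortest paths.\<close>

lemma K2_gains: "shortest_gains K2 (\<lambda>_. 1) 0 1 = {1}"
proof -
  have conn: "Digraph_Component.connected (with_proj K2)" and tg: "tgain_graph K2 (\<lambda>_. 1)"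
    using ordered_connected_K2 by (auto simp: ordered_connected_tgain_graph_def)
  interpret tgain_graph K2 "\<lambda>_. 1" by (rule tg)
  have "path_gain (\<lambda>_. 1) p = 1" for p :: "(nat \<times> nat) list"
    by (induction p) (auto simp: path_gain_def)
  thus ?thesis
    using shortest_gains_nonempty[OF conn, of 0 1] by (auto simp: shortest_gains_def)
qed

lemma K2_lex: "lex_Max (shortest_gains K2 (\<lambda>_. 1) 0 1) = 1"
    "lex_Min (shortest_gains K2 (\<lambda>_. 1) 0 1) = 1"
  using lex_Max_in[of "{1}"] lex_Min_in[of "{1}"] unfolding K2_gains by auto

text \<open>Adding the two eigenvector equations gives \<open>e * (v $ 0 + v $ 1) = 0\<close>.
  Either \<open>e = 0\<close>, or the entries are opposite and nonzero and the first equation forces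
  \<open>e = 2\<close>.\<close>

lemma spectral_radius_edge_Laplacian_le:
  assumes A: "A \<in> carrier_mat 2 2"
    and entries: "A $$ (0, 0) = 1" "A $$ (0, 1) = -1" "A $$ (1, 0) = -1" "A $$ (1, 1) = 1"
  shows "spectral_radius A \<le> 2"
proof -
  obtain e where e: "eigenvalue A e" "spectral_radius A = cmod e"
    using spectral_radius_mem_max(1)[OF A] by (auto simp: spectrum_def)
  then obtain v where v: "v \<in> carrier_vec 2" "v \<noteq> 0\<^sub>v 2" "A *\<^sub>v v = e \<cdot>\<^sub>v v"
    using A by (auto simp: eigenvalue_def eigenvector_def)
  have row: "A $$ (i, 0) * v $ 0 + A $$ (i, 1) * v $ 1 = e * v $ i" if "i < 2" for i
  proof -
    have "(A *\<^sub>v v) $ i = (e \<cdot>\<^sub>v v) $ i" by (simp only: v(3))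
    thus ?thesis using that A v(1) by (simp add: scalar_prod_def numeral_2_eq_2)
  qed
  have r0: "v $ 0 - v $ 1 = e * v $ 0" and r1: "v $ 1 - v $ 0 = e * v $ 1"
    using row[of 0] row[of 1] entries by simp_all
  have "v $ 0 \<noteq> 0 \<or> v $ 1 \<noteq> 0"
  proof (rule ccontr)
    assume "\<not> ?thesis"
    hence "v = 0\<^sub>v 2" using v(1) by (intro eq_vecI) (auto simp: less_2_cases_iff)
    thus False using v(2) by simp
  qed
  moreover have "e * (v $ 0 + v $ 1) = 0"
    unfolding distrib_left r0[symmetric] r1[symmetric] by simp
  ultimately have "e = 0 \<or> v $ 1 = - v $ 0 \<and> v $ 0 \<noteq> 0"
    by (auto simp: add_eq_0_iff2 add_eq_0_iff)
  hence "e = 0 \<or> e = 2" using r0 by auto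
  thus ?thesis using e(2) by auto
qed

lemma K2_sharp:
  "spectral_radius (DLmax K2 (\<lambda>_. 1) {(0, 1)} [0, 1])
     = 2 * wiener_index K2 [0, 1] / (real (card (pverts K2)) - 1)" (is "?a = ?w")
  "spectral_radius (DLmin K2 (\<lambda>_. 1) {(0, 1)} [0, 1])
     = 2 * wiener_index K2 [0, 1] / (real (card (pverts K2)) - 1)" (is "?b = ?w")
proof -
  \<comment> \<open>The only pair of vertices has distance 1 and the denominator is 1.\<close>
  have w: "?w = 2"
    by (simp add: wiener_index_def K2_gdist[simplified] numeral_2_eq_2 lessThan_Suc)
  have tr: "transmission K2 0 = 1" "transmission K2 1 = 1"
    by (simp_all add: transmission_def K2_gdist[simplified])
  have carrier: "Tr_mat K2 [0, 1] - mat (length [0 :: nat, 1]) (length [0 :: nat, 1]) f \<in> carrier_mat 2 2"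
    for f by (rule carrier_matI) simp_all
  note entries = Tr_mat_def tr[simplified] gain_max_def gain_min_def
    K2_gdist[simplified] K2_lex[simplified]
  have "?a \<le> 2" "?b \<le> 2"
    unfolding DLmax_def Dmax_def DLmin_def Dmin_def
    by (rule spectral_radius_edge_Laplacian_le[OF carrier]; simp add: entries)+
  \<comment> \<open>The opposite inequalities are the general lower bound applied to this
    graph.\<close>
  thus "?a = ?w" "?b = ?w"
    using spectral_radius_DL_ge[OF ordered_connected_K2] unfolding w by linarith+
qed

theorem theorem4p1:
  shows "(\<forall>(G :: 'a pair_pre_digraph) \<phi> r vs. ordered_connected_tgain_graph G \<phi> r vs \<longrightarrow>
            spectral_radius (DLmax G \<phi> r vs)
              \<ge> 2 * wiener_index G vs / (real (card (pverts G)) - 1)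
          \<and> spectral_radius (DLmin G \<phi> r vs)
              \<ge> 2 * wiener_index G vs / (real (card (pverts G)) - 1))
       \<and> (\<exists>(G :: nat pair_pre_digraph) \<phi> r vs. ordered_connected_tgain_graph G \<phi> r vs \<and>
            spectral_radius (DLmax G \<phi> r vs)
              = 2 * wiener_index G vs / (real (card (pverts G)) - 1))
       \<and> (\<exists>(G :: nat pair_pre_digraph) \<phi> r vs. ordered_connected_tgain_graph G \<phi> r vs \<and>
            spectral_radius (DLmin G \<phi> r vs)
              = 2 * wiener_index G vs / (real (card (pverts G)) - 1))"
proof (intro conjI allI impI)
  show "\<exists>(G :: nat pair_pre_digraph) \<phi> r vs. ordered_connected_tgain_graph G \<phi> r vs \<and>
      spectral_radius (DLmax G \<phi> r vs) = 2 * wiener_index G vs / (real (card (pverts G)) - 1)"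
    by (intro exI conjI) (rule ordered_connected_K2, rule K2_sharp)
  show "\<exists>(G :: nat pair_pre_digraph) \<phi> r vs. ordered_connected_tgain_graph G \<phi> r vs \<and>
      spectral_radius (DLmin G \<phi> r vs) = 2 * wiener_index G vs / (real (card (pverts G)) - 1)"
    by (intro exI conjI) (rule ordered_connected_K2, rule K2_sharp)
qed (simp_all only: spectral_radius_DL_ge)

end
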